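(* Let $(X,\|\cdot\|)$ be a real normed space, $x_0\in S_X$, and suppose that $x_0$, as a point of $B_X$, is strongly exposed by $x^*\in S_{X^*}$. Let $h\colon[0,\infty)\to\mathbb{R}$ be a continuous convex strictly increasing function, let $\lambda\in(0,\infty)$ and $\lambda^*\in\mathbb{R}$, and suppose that $\lambda$ is a $\lambda^*$-small diameter point for $h$. Then: (i) $h(\|\cdot\|)$ is a continuous convex function on $X$; (ii) $\lambda x_0$ is a $\lambda^*x^*$-small diameter point for $h(\|\cdot\|)$; (iii) the origin of $X$ is a $0$-small diameter point for $h(\|\cdot\|)$, where $0\in X^*$ denotes the null functional.
   Context: $X$ is nontrivial; $X^*$ is its topological dual; $B_X$ and $S_X$ denote the closed unit ball and the unit sphere of $X$ (similarly $S_{X^*}$). For a convex subset $D$ of a normed space, a point $x\in D$ is strongly exposed by $x^*\in X^*\setminus\{0\}$ if $x^*(x)=\sup_D x^*$ and $x_n\to x$ in norm for every sequence $\{x_n\}\subset D$ with $\lim_n x^*(x_n)=\sup_D x^*$. For a convex subset $D$ of a normed space $Y$, $f\colon D\to\mathbb{R}$ continuous convex, and $x\in D$, the subdifferential is $\partial f(x)=\{y^*\in Y^*: y^*(y-x)\le f(y)-f(x)\ \forall y\in D\}$. A point $x\in D$ is a $y^*$-small diameter point for $f$ if $y^*\in\partial f(x)$ and every sequence $\{x_n\}\subset D$ with $y^*(x_n)-f(x_n)\to y^*(x)-f(x)$ is norm convergent. For $h$ this is applied with $Y=\mathbb{R}$, $D=[0,\infty)$ and $\lambda^*\in\mathbb{R}$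 identified with the functional $s\mapsto\lambda^*s$; for $h(\|\cdot\|)$ with $Y=D=X$. *)

theory Defs
  imports "HOL-Analysis.Analysis"
begin

text \<open>
  The topological dual of a real normed space \<open>'a\<close> is \<open>'a \<Rightarrow>\<^sub>L real\<close>, with the operator norm.
  The standing assumptions on the data (\<open>D\<close> convex, \<open>f\<close> continuous and convex on \<open>D\<close>) are not
  part of the definitions below.
\<close>

text \<open>
  \<open>Sup\<close> on the reals is unspecified for sets that are not bounded above, so finiteness of
  the supremum is required explicitly.
\<close>

definition strongly_exposed_by ::
    "'a::real_normed_vector set \<Rightarrow> 'a \<Rightarrow> ('a \<Rightarrow>\<^sub>L real) \<Rightarrow> bool" where
  "strongly_exposed_by D x xs \<longleftrightarrow>
     x \<in> D \<and> xs \<noteq> 0 \<and>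
     bdd_above (blinfun_apply xs ` D) \<and>
     blinfun_apply xs x = (SUP y\<in>D. blinfun_apply xs y) \<and>
     (\<forall>u :: nat \<Rightarrow> 'a.
        (\<forall>n. u n \<in> D) \<and>
        (\<lambda>n. blinfun_apply xs (u n)) \<longlonglongrightarrow> (SUP y\<in>D. blinfun_apply xs y)
        \<longrightarrow> u \<longlonglongrightarrow> x)"

definition subdifferential ::
    "'a::real_normed_vector set \<Rightarrow> ('a \<Rightarrow> real) \<Rightarrow> 'a \<Rightarrow> ('a \<Rightarrow>\<^sub>L real) set" where
  "subdifferential D f x =
     {ys. \<forall>y\<in>D. blinfun_apply ys (y - x) \<le> f y - f x}"

definition small_diameter_point ::
    "'a::real_normed_vector set \<Rightarrow> ('a \<Rightarrow> real) \<Rightarrow> ('a \<Rightarrow>\<^sub>L real) \<Rightarrow> 'a \<Rightarrow> bool" where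
  "small_diameter_point D f ys x \<longleftrightarrow>
     x \<in> D \<and> ys \<in> subdifferential D f x \<and>
     (\<forall>u :: nat \<Rightarrow> 'a.
        (\<forall>n. u n \<in> D) \<and>
        (\<lambda>n. blinfun_apply ys (u n) - f (u n)) \<longlonglongrightarrow> blinfun_apply ys x - f x
        \<longrightarrow> convergent u)"

end

theory Submission
  imports Defs
begin

text \<open>
  The functional \<open>xs\<close> turns questions about a vector \<open>y\<close> into questions about the scalar
  \<open>norm y\<close>.  Since \<open>ls > 0\<close> (test the subgradient inequality at \<open>l\<close> against \<open>0\<close> and use that \<open>h\<close>
  is strictly increasing) and \<open>xs y \<le> norm y\<close>, with equality at \<open>l *\<^sub>R x0\<close>, one has

  \<open>ls * xs y - h (norm y) \<le> ls * norm y - h (norm y) \<le> ls * l - h l\<close>.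

  This is the subgradient inequality at \<open>l *\<^sub>R x0\<close>.  If the left side tends to the right side
  along a sequence \<open>u\<close>, then both gaps vanish.  The second gap forces \<open>norm (u n)\<close> to tend to \<open>l\<close>:
  at a small diameter point, a maximizing sequence can only converge to the point itself
  (\<open>small_diameter_point_tendsto\<close>).  The first gap then forces \<open>xs (sgn (u n))\<close> to tend to \<open>1\<close>, so
  the directions \<open>sgn (u n)\<close> tend to \<open>x0\<close> by strong exposedness, and \<open>u\<close> tends to \<open>l *\<^sub>R x0\<close>
  (\<open>tendsto_scaleR_exposed_point\<close>).

  For the origin, strict monotonicity makes \<open>h\<close> detect convergence to the left endpoint
  of its domain: if \<open>h (norm (u n))\<close> tends to \<open>h 0\<close>, then \<open>u\<close> tends to \<open>0\<close>.
\<close>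

text \<open>
  Interleaving the sequence with the constant sequence \<open>x\<close> gives another maximizing sequence; it
  has to converge, and its even terms fix the limit.
\<close>

lemma small_diameter_point_tendsto:
  assumes sdp: "small_diameter_point D f ys x"
    and uD: "\<And>n. u n \<in> D"
    and lim: "(\<lambda>n. blinfun_apply ys (u n) - f (u n)) \<longlonglongrightarrow> blinfun_apply ys x - f x"
  shows "u \<longlonglongrightarrow> x"
proof -
  define v where "v n = (if even n then x else u (n div 2))" for n :: nat
  let ?g = "\<lambda>y. blinfun_apply ys y - f y"
  have "filterlim (\<lambda>n::nat. n div 2) sequentially sequentially"
    by (rule filterlim_at_top_mono[OF filterlim_at_top_div_const_nat[of 2]]) auto
  then have "(\<lambda>n. ?g (u (n div 2))) \<longlonglongrightarrow> ?g x"
    by (rule filterlim_compose[OF lim])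
  then have "(\<lambda>n. if even n then ?g x else ?g (u (n div 2))) \<longlonglongrightarrow> ?g x"
    by (intro filterlim_If tendsto_const tendsto_mono[OF inf_le1])
  then have "(\<lambda>n. ?g (v n)) \<longlonglongrightarrow> ?g x"
    by (rule tendsto_cong[THEN iffD1, rotated]) (auto simp: v_def)
  moreover have "\<forall>n. v n \<in> D"
    using sdp uD by (auto simp: v_def small_diameter_point_def)
  ultimately have "convergent v"
    using sdp unfolding small_diameter_point_def by blast
  then obtain z where z: "v \<longlonglongrightarrow> z"
    by (auto simp: convergent_def)
  have "(\<lambda>n. v (2 * n)) \<longlonglongrightarrow> z" "(\<lambda>n. v (2 * n + 1)) \<longlonglongrightarrow> z"
    using LIMSEQ_subseq_LIMSEQ[OF z, of "\<lambda>n. 2 * n"]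
      LIMSEQ_subseq_LIMSEQ[OF z, of "\<lambda>n. 2 * n + 1"]
    by (simp_all add: strict_mono_def o_def)
  then have "(\<lambda>n::nat. x) \<longlonglongrightarrow> z" "u \<longlonglongrightarrow> z"
    by (simp_all add: v_def)
  then show ?thesis
    using LIMSEQ_unique tendsto_const by metis
qed

lemma strongly_exposed_by_cball_apply:
  assumes "strongly_exposed_by (cball 0 1) x0 xs"
  shows "blinfun_apply xs x0 = norm xs"
proof (rule antisym)
  have x0: "norm x0 \<le> 1" and bdd: "bdd_above (blinfun_apply xs ` cball 0 1)"
    and sup: "blinfun_apply xs x0 = (SUP y\<in>cball 0 1. blinfun_apply xs y)"
    using assms by (auto simp: strongly_exposed_by_def)
  have le: "blinfun_apply xs y \<le> blinfun_apply xs x0" if "norm y \<le> 1" for y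
    unfolding sup using that by (intro cSUP_upper bdd) auto
  have "\<bar>blinfun_apply xs x0\<bar> \<le> norm xs * norm x0"
    using norm_blinfun[of xs x0] by simp
  also have "\<dots> \<le> norm xs"
    using x0 by (simp add: mult_left_le)
  finally show "blinfun_apply xs x0 \<le> norm xs" by simp
  show "norm xs \<le> blinfun_apply xs x0"
  proof (rule norm_blinfun_bound)
    show "0 \<le> blinfun_apply xs x0"
      using le[of 0] by (simp add: blinfun.zero_right)
    fix y :: 'a
    have "\<bar>blinfun_apply xs (sgn y)\<bar> \<le> blinfun_apply xs x0"
      using le[of "sgn y"] le[of "- sgn y"]
      by (simp add: norm_sgn blinfun.minus_right abs_le_iff)
    then have "norm y * \<bar>blinfun_apply xs (sgn y)\<bar> \<le> norm y * blinfun_apply xs x0"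
      by (simp add: mult_left_mono)
    moreover have "blinfun_apply xs y = norm y * blinfun_apply xs (sgn y)"
      by (cases "y = 0") (simp_all add: sgn_div_norm blinfun.scaleR_right blinfun.zero_right)
    ultimately show "norm (blinfun_apply xs y) \<le> blinfun_apply xs x0 * norm y"
      by (simp add: abs_mult mult.commute)
  qed
qed

text \<open>
  Strong exposedness speaks about the unit ball only; normalizing extends it to sequences whose
  norms converge to a positive number.  Positivity of the limit lets the values of \<open>xs\<close> at the
  normalized vectors converge as a quotient.
\<close>

lemma tendsto_scaleR_exposed_point:
  assumes se: "strongly_exposed_by (cball 0 1) x0 xs"
    and "0 < l"
    and nrm: "(\<lambda>n. norm (u n)) \<longlonglongrightarrow> l"
    and val: "(\<lambda>n. blinfun_apply xs (u n)) \<longlonglongrightarrow> l * norm xs"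
  shows "u \<longlonglongrightarrow> l *\<^sub>R x0"
proof -
  have "(\<lambda>n. blinfun_apply xs (u n) / norm (u n)) \<longlonglongrightarrow> l * norm xs / l"
    using nrm val \<open>0 < l\<close> by (intro tendsto_divide) auto
  moreover have "l * norm xs / l = norm xs"
    using \<open>0 < l\<close> by simp
  moreover have "blinfun_apply xs (sgn (u n)) = blinfun_apply xs (u n) / norm (u n)" for n
    by (simp add: sgn_div_norm blinfun.scaleR_right divide_inverse mult.commute)
  ultimately have "(\<lambda>n. blinfun_apply xs (sgn (u n))) \<longlonglongrightarrow> norm xs"
    by simp
  moreover have "norm xs = (SUP y\<in>cball 0 1. blinfun_apply xs y)"
    using se strongly_exposed_by_cball_apply[OF se] by (simp add: strongly_exposed_by_def)
  moreover have "sgn (u n) \<in> cball 0 1" for n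
    by (simp add: norm_sgn)
  ultimately have "(\<lambda>n. sgn (u n)) \<longlonglongrightarrow> x0"
    using se unfolding strongly_exposed_by_def by simp
  with nrm have "(\<lambda>n. norm (u n) *\<^sub>R sgn (u n)) \<longlonglongrightarrow> l *\<^sub>R x0"
    by (rule tendsto_scaleR)
  moreover have "norm (u n) *\<^sub>R sgn (u n) = u n" for n
    by (cases "u n = 0") (simp_all add: sgn_div_norm)
  ultimately show ?thesis by simp
qed

lemma convex_on_mono_norm:
  fixes h :: "real \<Rightarrow> real"
  assumes cvx: "convex_on {0..} h" and mono: "mono_on {0..} h"
  shows "convex_on UNIV (\<lambda>x::'a::real_normed_vector. h (norm x))"
proof (rule convex_onI)
  fix t :: real and x y :: 'a
  assume t: "0 < t" "t < 1"
  have "norm ((1 - t) *\<^sub>R x + t *\<^sub>R y) \<le> (1 - t) * norm x + t * norm y"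
    using norm_triangle_ineq[of "(1 - t) *\<^sub>R x" "t *\<^sub>R y"] t by simp
  then have "h (norm ((1 - t) *\<^sub>R x + t *\<^sub>R y)) \<le> h ((1 - t) * norm x + t * norm y)"
    using t by (intro mono_onD[OF mono]) auto
  also have "\<dots> \<le> (1 - t) * h (norm x) + t * h (norm y)"
    using convex_onD[OF cvx, of t "norm x" "norm y"] t by simp
  finally show "h (norm ((1 - t) *\<^sub>R x + t *\<^sub>R y)) \<le> (1 - t) * h (norm x) + t * h (norm y)" .
qed simp

text \<open>
  By strict monotonicity the sublevel set \<open>{x. h (norm x) < h e}\<close> with \<open>e > 0\<close> lies in the ball of
  radius \<open>e\<close>, and a sequence along which \<open>h (norm x)\<close> tends to its minimum \<open>h 0\<close> ends up in it.
\<close>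

lemma small_diameter_point_origin:
  fixes h :: "real \<Rightarrow> real"
  assumes mono: "strict_mono_on {0..} h"
  shows "small_diameter_point UNIV (\<lambda>x::'a::real_normed_vector. h (norm x)) 0 0"
proof -
  have "h 0 \<le> h (norm y)" for y :: 'a
    using strict_mono_on_leD[OF mono, of 0 "norm y"] by simp
  moreover have "convergent u"
    if "(\<lambda>n. - h (norm (u n))) \<longlonglongrightarrow> - h 0" for u :: "nat \<Rightarrow> 'a"
  proof -
    have lim: "(\<lambda>n. h (norm (u n))) \<longlonglongrightarrow> h 0"
      using tendsto_minus[OF that] by simp
    have "u \<longlonglongrightarrow> 0"
    proof (rule tendstoI)
      fix e :: real assume "0 < e"
      then have "h 0 < h e"
        using strict_mono_onD[OF mono, of 0 e] by simp
      with lim have "\<forall>\<^sub>F n in sequentially. h (norm (u n)) < h e"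
        by (rule order_tendstoD(2))
      then show "\<forall>\<^sub>F n in sequentially. dist (u n) 0 < e"
      proof eventually_elim
        case (elim n)
        then show ?case
          using strict_mono_on_leD[OF mono, of e "norm (u n)"] \<open>0 < e\<close>
          by (cases "e \<le> norm (u n)") auto
      qed
    qed
    then show ?thesis by (auto simp: convergent_def)
  qed
  ultimately show ?thesis
    by (simp add: small_diameter_point_def subdifferential_def blinfun.zero_left)
qed

lemma small_diameter_point_scaleR_exposed:
  fixes xs :: "'a::real_normed_vector \<Rightarrow>\<^sub>L real" and h :: "real \<Rightarrow> real"
  assumes nxs: "norm xs = 1"
    and se: "strongly_exposed_by (cball 0 1) x0 xs"
    and nx0: "norm x0 = 1"
    and mono: "strict_mono_on {0..} h"
    and l: "0 < l"
    and sdp: "small_diameter_point {0..} h (blinfun_mult_right ls) l"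
  shows "small_diameter_point UNIV (\<lambda>x. h (norm x)) (ls *\<^sub>R xs) (l *\<^sub>R x0)"
proof -
  have sub: "ls * (s - l) \<le> h s - h l" if "0 \<le> s" for s
    using sdp that by (auto simp: small_diameter_point_def subdifferential_def)
  have xs_le: "blinfun_apply xs y \<le> norm y" for y
    using norm_blinfun[of xs y] nxs by simp
  have xs_x0: "blinfun_apply xs x0 = 1"
    using strongly_exposed_by_cball_apply[OF se] nxs by simp
  have "0 < ls"
  proof -
    have "ls * l > 0"
      using sub[of 0] strict_mono_onD[OF mono, of 0 l] l by simp
    with l show ?thesis by (simp add: zero_less_mult_iff)
  qed
  then have ls_le: "ls * blinfun_apply xs y \<le> ls * norm y" for y
    using xs_le by simp
  have "ls * blinfun_apply xs (y - l *\<^sub>R x0) \<le> h (norm y) - h l" for y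
    using ls_le[of y] sub[of "norm y"]
    by (simp add: blinfun.diff_right blinfun.scaleR_right xs_x0 algebra_simps)
  moreover have "u \<longlonglongrightarrow> l *\<^sub>R x0"
    if u: "(\<lambda>n. ls * blinfun_apply xs (u n) - h (norm (u n))) \<longlonglongrightarrow> ls * l - h l" for u
  proof -
    have gap: "(\<lambda>n. ls * norm (u n) - h (norm (u n))) \<longlonglongrightarrow> ls * l - h l"
    proof (rule tendsto_sandwich[OF _ _ u tendsto_const])
      show "\<forall>\<^sub>F n in sequentially.
          ls * blinfun_apply xs (u n) - h (norm (u n)) \<le> ls * norm (u n) - h (norm (u n))"
        using ls_le by simp
      show "\<forall>\<^sub>F n in sequentially. ls * norm (u n) - h (norm (u n)) \<le> ls * l - h l"
      proof (intro always_eventually allI)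
        fix n
        show "ls * norm (u n) - h (norm (u n)) \<le> ls * l - h l"
          using sub[of "norm (u n)"] by (simp add: algebra_simps)
      qed
    qed
    have nrm: "(\<lambda>n. norm (u n)) \<longlonglongrightarrow> l"
      using gap by (intro small_diameter_point_tendsto[OF sdp]) simp_all
    \<comment> \<open>Subtracting the two convergent gaps removes \<open>h\<close>, and \<open>ls\<close> can be divided out.\<close>
    have "(\<lambda>n. ls * norm (u n) - (ls * norm (u n) - h (norm (u n)))
        + (ls * blinfun_apply xs (u n) - h (norm (u n)))) \<longlonglongrightarrow>
        ls * l - (ls * l - h l) + (ls * l - h l)"
      by (intro tendsto_intros nrm gap u)
    then have "(\<lambda>n. ls * blinfun_apply xs (u n)) \<longlonglongrightarrow> ls * l"
      by simp
    then have "(\<lambda>n. blinfun_apply xs (u n)) \<longlonglongrightarrow> l * norm xs"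
      using \<open>0 < ls\<close> nxs by (simp add: tendsto_mult_left_iff)
    then show ?thesis
      by (rule tendsto_scaleR_exposed_point[OF se l nrm])
  qed
  ultimately show ?thesis
    using nx0 l xs_x0
    by (auto simp: small_diameter_point_def subdifferential_def blinfun.scaleR_left
        blinfun.scaleR_right convergent_def mult.commute)
qed

theorem proposition2p4:
  fixes x0 :: "'a::real_normed_vector"
    and xs :: "'a \<Rightarrow>\<^sub>L real"
    and h :: "real \<Rightarrow> real"
    and l ls :: real
  assumes "x0 \<in> sphere 0 1"
    and "xs \<in> sphere 0 1"
    and "strongly_exposed_by (cball 0 1) x0 xs"
    and "continuous_on {0..} h"
    and "convex_on {0..} h"
    and "strict_mono_on {0..} h"
    and "0 < l"
    and "small_diameter_point {0..} h (blinfun_mult_right ls) l"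
  shows "(continuous_on UNIV (\<lambda>x::'a. h (norm x)) \<and> convex_on UNIV (\<lambda>x::'a. h (norm x)))
      \<and> small_diameter_point UNIV (\<lambda>x::'a. h (norm x)) (ls *\<^sub>R xs) (l *\<^sub>R x0)
      \<and> small_diameter_point UNIV (\<lambda>x::'a. h (norm x)) 0 0"
proof (intro conjI)
  have mono: "mono_on {0..} h"
    using assms(6) by (rule strict_mono_on_imp_mono_on)
  show "continuous_on UNIV (\<lambda>x::'a. h (norm x))"
    by (rule continuous_on_compose2[OF assms(4)]) (auto intro: continuous_intros)
  show "convex_on UNIV (\<lambda>x::'a. h (norm x))"
    using assms(5) mono by (rule convex_on_mono_norm)
  show "small_diameter_point UNIV (\<lambda>x::'a. h (norm x)) (ls *\<^sub>R xs) (l *\<^sub>R x0)"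
    using assms by (intro small_diameter_point_scaleR_exposed) simp_all
  show "small_diameter_point UNIV (\<lambda>x::'a. h (norm x)) 0 0"
    using assms(6) by (rule small_diameter_point_origin)
qed

end
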